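(* Let $S$ be a set and $\to\subseteq S\times S$ a binary relation. Let $P^\times,Q^\times\subseteq S\times S$, $F^\times\subseteq(S\times S)\times(S\times S)$, $P,Q\subseteq S$, $F\subseteq S\times S$ and $c_0,c_1:S\to\mathbb{N}$. Suppose that (0) $\mathrm{Ensures2}_{\to}(P^\times,Q^\times,F^\times,c_0,c_1)$ holds; (i) for every $s_1\in P$ there is $s_0$ with $(s_0,s_1)\in P^\times$; (ii) for all $s_0,s_1$, $(s_0,s_1)\in Q^\times$ implies $s_1\in Q$; (iii) there exists $F'\subseteq S\times S$ such that for all $s_0,s_1,s_0',s_1'\in S$, $((s_0,s_1),(s_0',s_1'))\in F^\times\iff\big((s_0,s_0')\in F'\wedge(s_1,s_1')\in F\big)$. Then $\mathrm{EnsuresN}_{\to}(P,Q,F,c_1)$ holds.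
   Context: For $n\in\mathbb{N}$, $\to^n$ denotes the $n$-fold composition of $\to$, with $\to^0$ the identity relation on $S$. For $n\in\mathbb{N}$ and $Q\subseteq S$, $\mathrm{EvN}_{\to}(n,Q)=\{s\in S\mid (\forall s'.\ s\to^n s'\Rightarrow s'\in Q)\wedge(\forall s'\,\forall l<n.\ s\to^l s'\Rightarrow\exists s''.\ s'\to s'')\}$. $\mathrm{EnsuresN}_{\to}(P,Q,F,c)$ (for $P,Q\subseteq S$, $F\subseteq S\times S$, $c:S\to\mathbb{N}$) means: for all $s\in P$, $s\in\mathrm{EvN}_{\to}(c(s),\{s'\mid s'\in Q\wedge(s,s')\in F\})$. For $P,Q\subseteq S\times S$, $F\subseteq(S\times S)\times(S\times S)$ and $c_0,c_1:S\to\mathbb{N}$, $\mathrm{Ensures2}_{\to}(P,Q,F,c_0,c_1)$ means: for all $(s_0,s_1)\in P$, $s_0\in\mathrm{EvN}_{\to}\big(c_0(s_0),\{s_0'\mid s_1\in\mathrm{EvN}_{\to}(c_1(s_1),\{s_1'\mid (s_0',s_1')\in Q\wedge((s_0,s_1),(s_0',s_1'))\in F\})\}\big)$. Conditions (0)–(iii) together constitute the paper's "hybrid relational Hoare triple". *)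

theory Defs
  imports Main
begin

text \<open>The state space $S$ is the universe of the type variable \<open>'s\<close>; the step relation is an
  arbitrary set of pairs, whose $n$-fold composition is the library's \<open>r ^^ n\<close>.\<close>

definition EvN :: "('s \<times> 's) set \<Rightarrow> nat \<Rightarrow> 's set \<Rightarrow> 's set" where
  "EvN r n Q = {s. (\<forall>s'. (s, s') \<in> r ^^ n \<longrightarrow> s' \<in> Q) \<and>
                   (\<forall>s'. \<forall>l<n. (s, s') \<in> r ^^ l \<longrightarrow> (\<exists>s''. (s', s'') \<in> r))}"

definition EnsuresN ::
    "('s \<times> 's) set \<Rightarrow> 's set \<Rightarrow> 's set \<Rightarrow> ('s \<times> 's) set \<Rightarrow> ('s \<Rightarrow> nat) \<Rightarrow> bool" where
  "EnsuresN r P Q F c \<longleftrightarrow> (\<forall>s\<in>P. s \<in> EvN r (c s) {s'. s' \<in> Q \<and> (s, s') \<in> F})"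

definition Ensures2 ::
    "('s \<times> 's) set \<Rightarrow> ('s \<times> 's) set \<Rightarrow> ('s \<times> 's) set \<Rightarrow> (('s \<times> 's) \<times> ('s \<times> 's)) set
      \<Rightarrow> ('s \<Rightarrow> nat) \<Rightarrow> ('s \<Rightarrow> nat) \<Rightarrow> bool" where
  "Ensures2 r P Q F c0 c1 \<longleftrightarrow>
    (\<forall>(s0, s1)\<in>P.
      s0 \<in> EvN r (c0 s0)
        {s0'. s1 \<in> EvN r (c1 s1)
          {s1'. (s0', s1') \<in> Q \<and> ((s0, s1), (s0', s1')) \<in> F}})"

end

(* EvN asserts progress at every step before the n-th, so some n-step run exists; hence the
   postcondition of the left run is inhabited, and any left end state s0' gives a
   guarantee about all right runs, from which s0' can be discarded. *)
theory Submission
  imports Defs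
begin

text \<open>A run is extended one step at a time: the progress clause of \<open>EvN\<close> covers
  states reached in fewer than \<open>n\<close> steps, and \<open>Suc k \<le> n\<close> gives
  exactly the strict bound needed at length \<open>k\<close>.\<close>

lemma EvN_relpow_exists:
  assumes "s \<in> EvN r n Q" and "k \<le> n"
  shows "\<exists>s'. (s, s') \<in> r ^^ k"
  using assms(2)
proof (induction k)
  case 0
  then show ?case by simp
next
  case (Suc k)
  then obtain s' where s': "(s, s') \<in> r ^^ k"
    by auto
  moreover have "k < n"
    using Suc.prems by simp
  ultimately obtain s'' where "(s', s'') \<in> r"
    using assms(1) unfolding EvN_def by blast
  with s' show ?case
    by (blast intro: relpow_Suc_I)
qed

text \<open>With \<open>k = n\<close> the run ends in a state that the first clause of
  \<open>EvN\<close> puts into \<open>Q\<close>; for \<open>n = 0\<close> this is \<open>s\<close>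
  itself.\<close>

lemma EvN_nonempty:
  assumes "s \<in> EvN r n Q"
  shows "Q \<noteq> {}"
  using EvN_relpow_exists[OF assms order_refl] assms unfolding EvN_def by blast

lemma EvN_mono:
  assumes "s \<in> EvN r n Q" and "Q \<subseteq> Q'"
  shows "s \<in> EvN r n Q'"
  using assms unfolding EvN_def by blast

theorem theorem4:
  fixes r :: "('s \<times> 's) set"
    and Px Qx :: "('s \<times> 's) set"
    and Fx :: "(('s \<times> 's) \<times> ('s \<times> 's)) set"
    and P Q :: "'s set"
    and F :: "('s \<times> 's) set"
    and c0 c1 :: "'s \<Rightarrow> nat"
  assumes "Ensures2 r Px Qx Fx c0 c1"
    and "\<forall>s1\<in>P. \<exists>s0. (s0, s1) \<in> Px"
    and "\<forall>s0 s1. (s0, s1) \<in> Qx \<longrightarrow> s1 \<in> Q"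
    and "\<exists>F' :: ('s \<times> 's) set. \<forall>s0 s1 s0' s1'.
           ((s0, s1), (s0', s1')) \<in> Fx \<longleftrightarrow> (s0, s0') \<in> F' \<and> (s1, s1') \<in> F"
  shows "EnsuresN r P Q F c1"
  unfolding EnsuresN_def
proof
  fix s1
  assume "s1 \<in> P"
  with assms(2) obtain s0 where "(s0, s1) \<in> Px"
    by blast
  with assms(1) have "s0 \<in> EvN r (c0 s0)
      {s0'. s1 \<in> EvN r (c1 s1) {s1'. (s0', s1') \<in> Qx \<and> ((s0, s1), (s0', s1')) \<in> Fx}}"
    unfolding Ensures2_def by blast
  from EvN_nonempty[OF this] obtain s0' where
    "s1 \<in> EvN r (c1 s1) {s1'. (s0', s1') \<in> Qx \<and> ((s0, s1), (s0', s1')) \<in> Fx}"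
    by blast
  \<comment> \<open>The product form of \<open>Fx\<close> lets its right factor \<open>F\<close> be
    read off, whatever \<open>s0\<close> and \<open>s0'\<close> are; \<open>Qx\<close> likewise
    projects into \<open>Q\<close>.\<close>
  then show "s1 \<in> EvN r (c1 s1) {s'. s' \<in> Q \<and> (s1, s') \<in> F}"
    by (rule EvN_mono) (use assms(3,4) in blast)
qed

end
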